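(* Let $(X,d)$ be a complete $\mathrm{CAT}(0)$ space such that $\deg_{\operatorname{thr}}S$ is finite for every finite set $S\subseteq X$. Then for every compact set $K\subseteq X$ the closure of its convex hull $\operatorname{cl}\operatorname{co}K$ is compact.
   Context: A $\mathrm{CAT}(0)$ space is a geodesic metric space in which every geodesic triangle is at least as thin as its Euclidean comparison triangle; it is uniquely geodesic, and $[x,y]$ denotes the geodesic segment joining $x$ and $y$. A set $C\subseteq X$ is convex if $[x,y]\subseteq C$ for all $x,y\in C$; $\operatorname{co}S$ is the smallest convex set containing $S$, and $\operatorname{cl}$ denotes closure. The threading of $S\subseteq X$ is $\operatorname{thr}S:=\bigcup_{x,y\in S}[x,y]$, and iteratively $\operatorname{thr}^1S=\operatorname{thr}S$, $\operatorname{thr}^nS=\operatorname{thr}(\operatorname{thr}^{n-1}S)$; $\mathbb N=\{1,2,\dots\}$. The threading degree $\deg_{\operatorname{thr}}S$ is the smallest $n\in\mathbb N$ with $\operatorname{thr}^nS=\operatorname{co}S$ if such $n$ exists, and $+\infty$ otherwise. *)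

theory Defs
  imports "HOL-Analysis.Analysis" "HOL-Library.Extended_Nat"
begin

text \<open>A geodesic from \<open>x\<close> to \<open>y\<close>, parametrised by arc length on \<open>[0, dist x y]\<close>.\<close>

definition (in metric_space) geodesic_path :: "'a \<Rightarrow> 'a \<Rightarrow> (real \<Rightarrow> 'a) \<Rightarrow> bool" where
  "geodesic_path x y g \<longleftrightarrow>
     g 0 = x \<and> g (dist x y) = y \<and>
     (\<forall>s\<in>{0..dist x y}. \<forall>t\<in>{0..dist x y}. dist (g s) (g t) = \<bar>s - t\<bar>)"

definition (in metric_space) is_geodesic_segment :: "'a \<Rightarrow> 'a \<Rightarrow> 'a set \<Rightarrow> bool" where
  "is_geodesic_segment x y S \<longleftrightarrow> (\<exists>g. geodesic_path x y g \<and> S = g ` {0..dist x y})"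

definition (in metric_space) geodesic_triangle ::
    "'a \<Rightarrow> 'a \<Rightarrow> 'a \<Rightarrow> 'a set \<Rightarrow> 'a set \<Rightarrow> 'a set \<Rightarrow> bool" where
  "geodesic_triangle x y z A B C \<longleftrightarrow>
     is_geodesic_segment x y A \<and> is_geodesic_segment y z B \<and> is_geodesic_segment z x C"

definition (in metric_space) comparison_triangle ::
    "'a \<Rightarrow> 'a \<Rightarrow> 'a \<Rightarrow> real^2 \<Rightarrow> real^2 \<Rightarrow> real^2 \<Rightarrow> bool" where
  "comparison_triangle x y z x' y' z' \<longleftrightarrow>
     dist x' y' = dist x y \<and> dist y' z' = dist y z \<and> dist z' x' = dist z x"

text \<open>The point \<open>p'\<close> of the Euclidean segment from \<open>x'\<close> to \<open>y'\<close> corresponds to the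
  point \<open>p\<close> of a side \<open>A\<close> from \<open>x\<close> to \<open>y\<close>.\<close>

definition (in metric_space) side_comparison_point ::
    "'a \<Rightarrow> 'a set \<Rightarrow> real^2 \<Rightarrow> real^2 \<Rightarrow> 'a \<Rightarrow> real^2 \<Rightarrow> bool" where
  "side_comparison_point x A x' y' p p' \<longleftrightarrow>
     p \<in> A \<and> p' \<in> closed_segment x' y' \<and> dist x' p' = dist x p"

text \<open>A point lying on several sides has a comparison point for each of them.\<close>

definition (in metric_space) comparison_point ::
    "'a \<Rightarrow> 'a \<Rightarrow> 'a \<Rightarrow> 'a set \<Rightarrow> 'a set \<Rightarrow> 'a set \<Rightarrow>
     real^2 \<Rightarrow> real^2 \<Rightarrow> real^2 \<Rightarrow> 'a \<Rightarrow> real^2 \<Rightarrow> bool" where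
  "comparison_point x y z A B C x' y' z' p p' \<longleftrightarrow>
     side_comparison_point x A x' y' p p' \<or>
     side_comparison_point y B y' z' p p' \<or>
     side_comparison_point z C z' x' p p'"

class cat0_space = metric_space +
  assumes geodesic_space: "\<exists>S. is_geodesic_segment x y S"
    and cat0_inequality:
      "geodesic_triangle x y z A B C \<Longrightarrow>
       comparison_triangle x y z x' y' z' \<Longrightarrow>
       comparison_point x y z A B C x' y' z' p p' \<Longrightarrow>
       comparison_point x y z A B C x' y' z' q q' \<Longrightarrow>
       dist p q \<le> dist p' q'"

definition geodesic_segment :: "'a::cat0_space \<Rightarrow> 'a \<Rightarrow> 'a set" where
  "geodesic_segment x y = (THE S. is_geodesic_segment x y S)"

lemma geodesic_path_reverse:
  assumes "geodesic_path x y g"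
  shows "geodesic_path y x (\<lambda>t. g (dist x y - t))"
  using assms unfolding geodesic_path_def by (auto simp: dist_commute)

lemma is_geodesic_segment_sym:
  assumes "is_geodesic_segment x y S"
  shows "is_geodesic_segment y x S"
proof -
  from assms obtain g where g: "geodesic_path x y g" and S: "S = g ` {0..dist x y}"
    unfolding is_geodesic_segment_def by blast
  have "(\<lambda>t. g (dist x y - t)) ` {0..dist y x} = g ` ((\<lambda>t. dist x y - t) ` {0..dist x y})"
    by (simp only: image_image dist_commute)
  also have "\<dots> = S"
    by (simp add: S)
  finally show ?thesis
    using geodesic_path_reverse[OF g] unfolding is_geodesic_segment_def by metis
qed

lemma is_geodesic_segment_subset:
  fixes x y :: "'a::cat0_space"
  assumes S: "is_geodesic_segment x y S" and T: "is_geodesic_segment x y T"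
  shows "S \<subseteq> T"
proof
  fix p assume "p \<in> S"
  obtain g h where g: "geodesic_path x y g" "S = g ` {0..dist x y}"
    and h: "geodesic_path x y h" "T = h ` {0..dist x y}"
    using S T unfolding is_geodesic_segment_def by blast
  obtain t where t: "t \<in> {0..dist x y}" "p = g t"
    using \<open>p \<in> S\<close> g by blast
  define q where "q = h t"
  define y' :: "real^2" where "y' = dist x y *\<^sub>R axis 1 1"
  define t' :: "real^2" where "t' = t *\<^sub>R axis 1 1"
  have tri: "geodesic_triangle x y y S {y} T"
    using S is_geodesic_segment_sym[OF T]
    by (auto simp: geodesic_triangle_def is_geodesic_segment_def geodesic_path_def)
  have y': "norm y' = dist x y" and t': "norm t' = t" "norm (y' - t') = dist x y - t"
  proof -
    have "y' - t' = (dist x y - t) *\<^sub>R axis 1 1"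
      by (simp add: y'_def t'_def scaleR_diff_left)
    then show "norm (y' - t') = dist x y - t"
      using t by (simp add: norm_axis_1)
  qed (use t in \<open>auto simp: y'_def t'_def norm_axis_1\<close>)
  have cmp: "comparison_triangle x y y 0 y' y'"
    by (simp add: comparison_triangle_def y' dist_commute)
  have seg: "t' \<in> closed_segment 0 y'"
  proof (cases "dist x y = 0")
    case True
    then show ?thesis using t t' y' by simp
  next
    case False
    then have "t' = (t / dist x y) *\<^sub>R y'"
      by (simp add: y'_def t'_def)
    moreover have "0 \<le> t / dist x y" "t / dist x y \<le> 1"
      using t False by (auto simp: divide_simps)
    ultimately show ?thesis
      by (auto simp: in_segment)
  qed
  have p: "dist x p = t"
    using g t unfolding geodesic_path_def by (metis abs_minus_commute abs_of_nonneg
        atLeastAtMost_iff diff_zero order.refl zero_le_dist)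
  have q: "dist y q = dist x y - t"
  proof -
    have "h (dist x y) = y" "dist (h (dist x y)) (h t) = \<bar>dist x y - t\<bar>"
      using h(1) t(1) zero_le_dist[of x y] unfolding geodesic_path_def
      by (blast, metis atLeastAtMost_iff order.refl)
    then show ?thesis using t(1) by (simp add: q_def)
  qed
  have "q \<in> T" using h t by (simp add: q_def)
  have "dist p q \<le> dist t' t'"
  proof (rule cat0_inequality[OF tri cmp])
    show "comparison_point x y y S {y} T 0 y' y' p t'"
      using \<open>p \<in> S\<close> seg p t' by (simp add: comparison_point_def side_comparison_point_def)
    show "comparison_point x y y S {y} T 0 y' y' q t'"
      using \<open>q \<in> T\<close> seg q t'
      by (simp add: comparison_point_def side_comparison_point_def closed_segment_commute dist_norm)
  qed
  then show "p \<in> T" using \<open>q \<in> T\<close> by simp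
qed

lemma is_geodesic_segment_geodesic_segment:
  "is_geodesic_segment x y (geodesic_segment x y)"
  unfolding geodesic_segment_def
  by (rule theI') (meson geodesic_space is_geodesic_segment_subset subset_antisym)

lemma geodesic_segment_eqI: "is_geodesic_segment x y S \<Longrightarrow> geodesic_segment x y = S"
  by (meson is_geodesic_segment_geodesic_segment is_geodesic_segment_subset subset_antisym)

definition geodesically_convex :: "'a::cat0_space set \<Rightarrow> bool" where
  "geodesically_convex C \<longleftrightarrow> (\<forall>x\<in>C. \<forall>y\<in>C. geodesic_segment x y \<subseteq> C)"

definition co :: "'a::cat0_space set \<Rightarrow> 'a set" where
  "co S = geodesically_convex hull S"

definition thr :: "'a::cat0_space set \<Rightarrow> 'a set" where
  "thr S = (\<Union>x\<in>S. \<Union>y\<in>S. geodesic_segment x y)"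

definition deg_thr :: "'a::cat0_space set \<Rightarrow> enat" where
  "deg_thr S =
     (if \<exists>n\<ge>1. (thr ^^ n) S = co S
      then enat (LEAST n. n \<ge> 1 \<and> (thr ^^ n) S = co S)
      else \<infinity>)"

lemma geodesically_convex_co: "geodesically_convex (co S)"
  unfolding co_def by (rule hull_in) (simp add: geodesically_convex_def, blast)

end

theory Submission
  imports Defs
begin

text \<open>The hypothesis enters only through the compactness of \<open>co F\<close> for finite \<open>F\<close>: geodesics depend
  continuously on their endpoints, so threading preserves compactness, and \<open>co F\<close> is a finite
  iterate of threading. Given a compact \<open>K\<close> and \<open>e > 0\<close>, choose a finite \<open>e\<close>-net \<open>F\<close> of \<open>K\<close>.
  Convexity of the metric makes the closed \<open>e\<close>-neighbourhood of \<open>co F\<close> convex, so it contains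
  \<open>co K\<close>; hence \<open>co K\<close> is totally bounded, and completeness gives the claim.\<close>

section \<open>Euclidean comparison triangles\<close>

text \<open>\<open>cat0_inequality\<close> is usable only once a comparison triangle is at hand.
  With one vertex at the origin, points on the two sides issuing from it are scalar multiples of
  \<open>y'\<close> and \<open>z'\<close>.\<close>

lemma comparison_triangle_exists:
  fixes x y z :: "'a::metric_space"
  obtains y' z' :: "real^2" where "comparison_triangle x y z 0 y' z'"
proof -
  define a b c where "a = dist x y" and "b = dist x z" and "c = dist y z"
  have tri: "a \<le> b + c" "b \<le> a + c" "c \<le> a + b" and nonneg: "a \<ge> 0" "b \<ge> 0" "c \<ge> 0"
    unfolding a_def b_def c_def
    using dist_triangle[of x y z] dist_triangle[of x z y] dist_triangle[of y z x]
    by (auto simp: dist_commute)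
  \<comment> \<open>For \<open>a > 0\<close> this is the law of cosines; division by zero gives \<open>u = 0\<close>, which also works for \<open>a = 0\<close>.\<close>
  define u where "u = (a\<^sup>2 + b\<^sup>2 - c\<^sup>2) / (2 * a)"
  define v where "v = sqrt (b\<^sup>2 - u\<^sup>2)"
  have u: "2 * a * u = a\<^sup>2 + b\<^sup>2 - c\<^sup>2"
    using tri by (cases "a = 0") (auto simp: u_def)
  have "\<bar>u\<bar> \<le> b"
  proof (cases "a = 0")
    case False
    \<comment> \<open>The squared triangle inequalities bound \<open>2 * a * u\<close> by
      \<open>2 * a * b\<close> in absolute value, so the radicand of \<open>v\<close> is
      nonnegative.\<close>
    have "(a - b)\<^sup>2 \<le> c\<^sup>2" "c\<^sup>2 \<le> (a + b)\<^sup>2"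
      using tri nonneg by (auto intro!: power_mono simp flip: abs_le_square_iff)
    then have "\<bar>2 * a * u\<bar> \<le> 2 * a * b"
      unfolding u by (simp add: abs_le_iff power2_eq_square algebra_simps)
    then show ?thesis
      using False nonneg by (simp add: abs_mult)
  qed (use nonneg in \<open>simp add: u_def\<close>)
  then have v: "v\<^sup>2 = b\<^sup>2 - u\<^sup>2"
    unfolding v_def by (simp add: abs_le_square_iff[symmetric] nonneg)
  define y' z' :: "real^2" where "y' = vector [a, 0]" and "z' = vector [u, v]"
  have "norm y' = a"
    by (simp add: y'_def norm_vec_def L2_set_def UNIV_2 nonneg)
  moreover have "norm z' = b"
    by (simp add: z'_def norm_vec_def L2_set_def UNIV_2 nonneg v)
  moreover have "dist y' z' = c"
  proof -
    have "(a - u)\<^sup>2 + v\<^sup>2 = c\<^sup>2"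
      using u v by (simp add: power2_eq_square algebra_simps)
    then show ?thesis
      by (simp add: y'_def z'_def dist_norm norm_vec_def L2_set_def UNIV_2 nonneg)
  qed
  ultimately have "comparison_triangle x y z 0 y' z'"
    by (simp add: comparison_triangle_def a_def b_def c_def dist_commute)
  then show thesis
    by (rule that)
qed

section \<open>Geodesics parametrised proportionally on \<open>{0..1}\<close>, so that paths of
  different lengths can be compared\<close>

lemma dist_geodesic_path_proportional:
  assumes "geodesic_path x y g" "s \<in> {0..1}" "t \<in> {0..1}"
  shows "dist (g (s * dist x y)) (g (t * dist x y)) = \<bar>s - t\<bar> * dist x y"
proof -
  have "s * dist x y \<in> {0..dist x y}" "t * dist x y \<in> {0..dist x y}"
    using assms(2,3) by (auto simp: mult_left_le_one_le)
  then show ?thesis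
    using assms(1) by (simp add: geodesic_path_def abs_mult flip: left_diff_distrib)
qed

lemma geodesic_path_in_geodesic_segment:
  fixes x y :: "'a::cat0_space"
  assumes g: "geodesic_path x y g" and t: "t \<in> {0..1}"
  shows "g (t * dist x y) \<in> geodesic_segment x y"
proof -
  have "geodesic_segment x y = g ` {0..dist x y}"
    using g by (intro geodesic_segment_eqI) (auto simp: is_geodesic_segment_def)
  moreover have "t * dist x y \<in> {0..dist x y}"
    using t by (auto simp: mult_left_le_one_le)
  ultimately show ?thesis
    by blast
qed

lemma geodesic_segmentE:
  fixes x y :: "'a::cat0_space"
  assumes p: "p \<in> geodesic_segment x y" and g: "geodesic_path x y g"
  obtains t where "t \<in> {0..1}" "p = g (t * dist x y)"
proof -
  have "geodesic_segment x y = g ` {0..dist x y}"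
    using g by (intro geodesic_segment_eqI) (auto simp: is_geodesic_segment_def)
  then obtain r where r: "r \<in> {0..dist x y}" "p = g r"
    using p by blast
  show thesis
  proof (cases "dist x y = 0")
    case True
    then show thesis using r that[of 0] by auto
  next
    case False
    then show thesis using r that[of "r / dist x y"] by (auto simp: divide_simps)
  qed
qed

lemma geodesic_path_exists:
  fixes x y :: "'a::cat0_space"
  obtains g where "geodesic_path x y g"
  using geodesic_space[of x y] unfolding is_geodesic_segment_def by blast

section \<open>Convexity of the metric\<close>

text \<open>In the comparison triangle with apex at the origin, the two points are the images of
  \<open>y'\<close> and \<open>z'\<close> under scaling by \<open>t\<close>, so their Euclidean
  distance is exactly the right-hand side.\<close>

lemma dist_geodesic_paths_common_start:
  fixes x y z :: "'a::cat0_space"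
  assumes g: "geodesic_path x y g" and h: "geodesic_path x z h" and t: "t \<in> {0..1}"
  shows "dist (g (t * dist x y)) (h (t * dist x z)) \<le> t * dist y z"
proof -
  obtain y' z' :: "real^2" where cmp: "comparison_triangle x y z 0 y' z'"
    by (rule comparison_triangle_exists)
  then have norms: "norm y' = dist x y" "norm z' = dist x z" "dist y' z' = dist y z"
    by (auto simp: comparison_triangle_def dist_commute)
  define A B C where "A = g ` {0..dist x y}" and "B = geodesic_segment y z"
    and "C = h ` {0..dist x z}"
  have "is_geodesic_segment x y A" "is_geodesic_segment x z C"
    using g h by (auto simp: is_geodesic_segment_def A_def C_def)
  then have tri: "geodesic_triangle x y z A B C"
    by (simp add: geodesic_triangle_def B_def is_geodesic_segment_geodesic_segment
        is_geodesic_segment_sym)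
  have mem: "g (t * dist x y) \<in> A" "h (t * dist x z) \<in> C"
    using t by (auto simp: A_def C_def mult_left_le_one_le)
  have dg: "dist x (g (t * dist x y)) = t * dist x y"
    using dist_geodesic_path_proportional[OF g _ t, of 0] t g
    by (simp add: geodesic_path_def)
  \<comment> \<open>The side \<open>C\<close> is oriented from \<open>z\<close> to \<open>x\<close>,
    so its comparison points are measured from \<open>z\<close>.\<close>
  have dh: "dist z (h (t * dist x z)) = (1 - t) * dist x z"
    using dist_geodesic_path_proportional[OF h _ t, of 1] t h
    by (simp add: geodesic_path_def)
  have "dist (g (t * dist x y)) (h (t * dist x z)) \<le> dist (t *\<^sub>R y') (t *\<^sub>R z')"
  proof (rule cat0_inequality[OF tri cmp])
    have "t *\<^sub>R y' \<in> closed_segment 0 y'"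
      using t by (auto simp: in_segment)
    then have "side_comparison_point x A 0 y' (g (t * dist x y)) (t *\<^sub>R y')"
      using mem t by (simp add: side_comparison_point_def dg norms)
    then show "comparison_point x y z A B C 0 y' z' (g (t * dist x y)) (t *\<^sub>R y')"
      by (simp add: comparison_point_def)
    have "t *\<^sub>R z' \<in> closed_segment z' 0"
      using t by (subst closed_segment_commute) (auto simp: in_segment)
    moreover have "z' - t *\<^sub>R z' = (1 - t) *\<^sub>R z'"
      by (simp add: algebra_simps)
    then have "dist z' (t *\<^sub>R z') = (1 - t) * dist x z"
      using t by (simp add: dist_norm norms)
    ultimately have "side_comparison_point z C z' 0 (h (t * dist x z)) (t *\<^sub>R z')"
      using mem by (simp add: side_comparison_point_def dh)
    then show "comparison_point x y z A B C 0 y' z' (h (t * dist x z)) (t *\<^sub>R z')"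
      by (simp add: comparison_point_def)
  qed
  also have "\<dots> = t * dist y z"
    using t norms(3) by (simp add: dist_norm flip: scaleR_diff_right)
  finally show ?thesis .
qed

text \<open>The diagonal from \<open>x\<close> to \<open>y'\<close> splits the quadrilateral into
  two triangles, each handled by the common-start estimate.\<close>

theorem dist_geodesic_paths_convex:
  fixes x y x' y' :: "'a::cat0_space"
  assumes g: "geodesic_path x y g" and k: "geodesic_path x' y' k" and t: "t \<in> {0..1}"
  shows "dist (g (t * dist x y)) (k (t * dist x' y')) \<le> (1 - t) * dist x x' + t * dist y y'"
proof -
  obtain h where h: "geodesic_path x y' h"
    by (rule geodesic_path_exists)
  \<comment> \<open>\<open>h\<close> and \<open>k\<close> share their end \<open>y'\<close>;
    reversing both makes it a common start and turns \<open>t\<close> into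
    \<open>1 - t\<close>.\<close>
  have "dist (h (t * dist x y')) (k (t * dist x' y')) \<le> (1 - t) * dist x x'"
    using dist_geodesic_paths_common_start
      [OF geodesic_path_reverse[OF h] geodesic_path_reverse[OF k], of "1 - t"] t
    by (simp add: dist_commute[of y'] algebra_simps)
  then show ?thesis
    using dist_geodesic_paths_common_start[OF g h t]
      dist_triangle[of "g (t * dist x y)" "k (t * dist x' y')" "h (t * dist x y')"]
    by linarith
qed

text \<open>A geodesic between points near \<open>C\<close> is followed, at equal proportional
  parameter, by the geodesic between nearby points of \<open>C\<close>, which stays in
  \<open>C\<close>.\<close>

lemma geodesically_convex_neighbourhood:
  assumes C: "geodesically_convex C"
  shows "geodesically_convex {p. \<exists>q\<in>C. dist p q \<le> e}"
  unfolding geodesically_convex_def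
proof safe
  fix x y x' y' p
  assume xy: "x' \<in> C" "dist x x' \<le> e" "y' \<in> C" "dist y y' \<le> e"
    and p: "p \<in> geodesic_segment x y"
  obtain g where g: "geodesic_path x y g"
    by (rule geodesic_path_exists)
  obtain k where k: "geodesic_path x' y' k"
    by (rule geodesic_path_exists)
  obtain t where t: "t \<in> {0..1}" "p = g (t * dist x y)"
    using geodesic_segmentE[OF p g] .
  have "dist p (k (t * dist x' y')) \<le> (1 - t) * dist x x' + t * dist y y'"
    using dist_geodesic_paths_convex[OF g k] t by simp
  also have "\<dots> \<le> e"
    using xy t by (intro convex_bound_le) auto
  finally show "\<exists>q\<in>C. dist p q \<le> e"
    using geodesic_path_in_geodesic_segment[OF k t(1)] C xy
    unfolding geodesically_convex_def by blast
qed

section \<open>Threading as a continuous image\<close>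

text \<open>For \<open>t\<close> in \<open>{0..1}\<close> the value is independent of the chosen
  path, by \<open>dist_geodesic_paths_convex\<close> with equal endpoints.\<close>

definition geodesic_point :: "'a::cat0_space \<Rightarrow> 'a \<Rightarrow> real \<Rightarrow> 'a" where
  "geodesic_point x y t = (SOME g. geodesic_path x y g) (t * dist x y)"

lemma geodesic_path_some: "geodesic_path x y (SOME g. geodesic_path (x::'a::cat0_space) y g)"
  by (metis geodesic_path_exists someI)

lemma thr_eq_image:
  "thr S = (\<lambda>(x, y, t). geodesic_point x y t) ` (S \<times> S \<times> {0..1})"
  unfolding thr_def geodesic_point_def
  by (force elim!: geodesic_segmentE[OF _ geodesic_path_some]
      intro: geodesic_path_in_geodesic_segment[OF geodesic_path_some])

text \<open>Move the endpoints at fixed parameter \<open>s\<close> first, then the parameter along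
  the fixed geodesic from \<open>x\<close> to \<open>y\<close>.\<close>

lemma dist_geodesic_point_le:
  assumes "s \<in> {0..1}" "t \<in> {0..1}"
  shows "dist (geodesic_point x' y' s) (geodesic_point x y t)
    \<le> dist x' x + dist y' y + \<bar>s - t\<bar> * dist x y"
proof -
  have "dist (geodesic_point x' y' s) (geodesic_point x y s) \<le> (1 - s) * dist x' x + s * dist y' y"
    unfolding geodesic_point_def
    by (rule dist_geodesic_paths_convex[OF geodesic_path_some geodesic_path_some assms(1)])
  also have "\<dots> \<le> dist x' x + dist y' y"
    using assms by (intro add_mono mult_left_le_one_le) auto
  finally show ?thesis
    using dist_geodesic_path_proportional[OF geodesic_path_some assms, of x y]
      dist_triangle[of "geodesic_point x' y' s" "geodesic_point x y t" "geodesic_point x y s"]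
    unfolding geodesic_point_def by linarith
qed

lemma continuous_on_geodesic_point:
  "continuous_on (S \<times> S \<times> {0..1}) (\<lambda>(x, y, t). geodesic_point x y t)"
proof -
  have "((\<lambda>(x, y, t). geodesic_point x y t) \<longlongrightarrow> geodesic_point x y t)
      (at (x, y, t) within S \<times> S \<times> {0..1})" if t: "t \<in> {0..1}" for x y :: 'a and t
  proof (rule metric_tendsto_imp_tendsto)
    let ?F = "at (x, y, t) within S \<times> S \<times> {0..1}"
    \<comment> \<open>The bound of \<open>dist_geodesic_point_le\<close> as a function of the moving
      triple: continuous, and zero at \<open>(x, y, t)\<close>.\<close>
    let ?r = "\<lambda>w. dist (fst w) x + dist (fst (snd w)) y + \<bar>snd (snd w) - t\<bar> * dist x y"
    have "(?r \<longlongrightarrow> ?r (x, y, t)) ?F"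
      by (intro tendsto_intros)
    then show "(?r \<longlongrightarrow> 0) ?F"
      by simp
    show "\<forall>\<^sub>F w in ?F. dist ((\<lambda>(x, y, t). geodesic_point x y t) w) (geodesic_point x y t)
        \<le> dist (?r w) 0"
      unfolding eventually_at_filter
    proof (intro always_eventually allI impI)
      fix w assume "w \<in> S \<times> S \<times> {0..1::real}"
      then show "dist ((\<lambda>(x, y, t). geodesic_point x y t) w) (geodesic_point x y t)
          \<le> dist (?r w) 0"
        using dist_geodesic_point_le[OF _ t, of "snd (snd w)" "fst w" "fst (snd w)" x y]
        by (auto simp: split_beta dist_real_def)
    qed
  qed
  then show ?thesis
    by (force simp: continuous_on_def)
qed

lemma compact_thr: "compact S \<Longrightarrow> compact (thr S)"
  unfolding thr_eq_image
  by (intro compact_continuous_image continuous_on_geodesic_point compact_Times) auto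

lemma compact_co_finite_deg_thr:
  assumes "deg_thr S < \<infinity>" "compact S"
  shows "compact (co S)"
proof -
  obtain n where "(thr ^^ n) S = co S"
    using assms(1) by (auto simp: deg_thr_def split: if_splits)
  moreover have "compact ((thr ^^ n) S)"
    by (induction n) (auto intro: compact_thr assms(2))
  ultimately show ?thesis
    by simp
qed

section \<open>Total boundedness of the convex hull\<close>

lemma co_subset_neighbourhood:
  assumes "K \<subseteq> (\<Union>x\<in>F. ball x e)"
  shows "co K \<subseteq> {p. \<exists>q\<in>co F. dist p q \<le> e}"
  unfolding co_def[of K]
proof (rule hull_minimal)
  have "F \<subseteq> co F"
    unfolding co_def by (rule hull_subset)
  then show "K \<subseteq> {p. \<exists>q\<in>co F. dist p q \<le> e}"
    using assms unfolding ball_def by (fastforce simp: dist_commute intro: less_imp_le)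
  show "geodesically_convex {p. \<exists>q\<in>co F. dist p q \<le> e}"
    by (intro geodesically_convex_neighbourhood geodesically_convex_co)
qed

theorem corollary7:
  assumes "\<forall>S :: 'a::{cat0_space, complete_space} set. finite S \<longrightarrow> deg_thr S < \<infinity>"
  shows "\<forall>K :: 'a set. compact K \<longrightarrow> compact (closure (co K))"
proof (intro allI impI)
  fix K :: "'a set"
  assume K: "compact K"
  show "compact (closure (co K))"
    unfolding compact_eq_totally_bounded
  proof (intro conjI allI impI)
    show "complete (closure (co K))"
      by (simp add: complete_eq_closed)
    fix e :: real
    assume "e > 0"
    \<comment> \<open>One third is spent on the net of \<open>K\<close>, one on the net of
      \<open>co F\<close>, and the last on passing from closed to open balls.\<close>
    then have e: "e / 3 > 0"
      by simp
    obtain F where F: "finite F" "K \<subseteq> (\<Union>x\<in>F. ball x (e / 3))"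
      using K e unfolding compact_eq_totally_bounded by meson
    have "compact (co F)"
      using assms F(1) by (intro compact_co_finite_deg_thr finite_imp_compact) auto
    then obtain G where G: "finite G" "co F \<subseteq> (\<Union>x\<in>G. ball x (e / 3))"
      using e unfolding compact_eq_totally_bounded by meson
    have "co K \<subseteq> (\<Union>x\<in>G. cball x (2 * e / 3))"
    proof
      fix p assume "p \<in> co K"
      then obtain q where "q \<in> co F" "dist p q \<le> e / 3"
        using co_subset_neighbourhood[OF F(2)] by blast
      moreover from this obtain x where "x \<in> G" "dist x q < e / 3"
        using G(2) by auto
      ultimately show "p \<in> (\<Union>x\<in>G. cball x (2 * e / 3))"
        using dist_triangle2[of x p q] by force
    qed
    \<comment> \<open>A finite union of closed balls is closed, so the cover extends to the
      closure.\<close>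
    then have "closure (co K) \<subseteq> (\<Union>x\<in>G. cball x (2 * e / 3))"
      using G(1) by (intro closure_minimal) auto
    also have "\<dots> \<subseteq> (\<Union>x\<in>G. ball x e)"
      using \<open>e > 0\<close> by fastforce
    finally show "\<exists>k. finite k \<and> closure (co K) \<subseteq> (\<Union>x\<in>k. ball x e)"
      using G(1) by blast
  qed
qed

end
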